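(* In the discrete Heisenberg group $H(\mathbb{Z})$ with generating set $S=\{a,b\}$, every geodesic word is a prefix of a dead end word.
   Context: The discrete Heisenberg group is $H(\mathbb{Z}) = \left\{ \begin{pmatrix}1 & n & k \\ 0 & 1 & m\\ 0 & 0 & 1\end{pmatrix} : n,m,k \in \mathbb{Z}\right\}$, with presentation $\langle a,b \mid [[a,b],a]=1,\ [[a,b],b]=1\rangle$, where $a,b$ correspond to $\begin{pmatrix}1 & 1 & 0 \\ 0 & 1 & 0\\ 0 & 0 & 1\end{pmatrix}$ and $\begin{pmatrix}1 & 0 & 0 \\ 0 & 1 & 1\\ 0 & 0 & 1\end{pmatrix}$ respectively, and $[u,v]=uvu^{-1}v^{-1}$. Put $S=\{a,b\}$ and $S^{-1}=\{a^{-1},b^{-1}\}$. $F(a,b)$ denotes the set of all finite words (not necessarily reduced) in the alphabet $S\cup S^{-1}$; for $w\in F(a,b)$, $|w|$ is its length (number of letters) and $[w]\in H(\mathbb{Z})$ the element it represents. For $g\in H(\mathbb{Z})$, $l(g)$ is the distance from $1$ to $g$ in the Cayley graph with respect to $S$, i.e. the least length of a word in $F(a,b)$ representing $g$. A word $w$ is geodesic if $l([w])=|w|$. A geodesic word $w$ is called a dead end word if $ws$ is not geodesic for every $s\in S\cup S^{-1}$. A word $w$ is regarded as a prefix of itself. *)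

theory Defs
  imports
    "HOL-Analysis.Analysis"
    "HOL-Algebra.Group"
    "HOL-Library.Sublist"
begin

definition heis_mat :: "int \<Rightarrow> int \<Rightarrow> int \<Rightarrow> int^3^3" where
  "heis_mat n m k =
     vector [vector [1, n, k],
             vector [0, 1, m],
             vector [0, 0, 1]]"

definition heisenberg :: "(int^3^3) monoid" where
  "heisenberg =
     \<lparr>carrier = {heis_mat n m k | n m k. True}, mult = (**), one = mat 1\<rparr>"

definition heis_a :: "int^3^3" where
  "heis_a = heis_mat 1 0 0"

definition heis_b :: "int^3^3" where
  "heis_b = heis_mat 0 1 0"

lemma heis_mat_mult:
  "heis_mat n m k ** heis_mat n' m' k' = heis_mat (n + n') (m + m') (k + k' + n * m')"
  by (simp add: heis_mat_def matrix_matrix_mult_def vec_eq_iff forall_3 sum_3)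

lemma heis_mat_one: "mat 1 = heis_mat 0 0 0"
  by (simp add: heis_mat_def mat_def vec_eq_iff forall_3)

lemma heis_mat_inject: "heis_mat n m k = heis_mat n' m' k' \<longleftrightarrow> n = n' \<and> m = m' \<and> k = k'"
  by (auto simp add: heis_mat_def vec_eq_iff forall_3)

lemma group_heisenberg: "group heisenberg"
proof (rule groupI)
  fix x assume "x \<in> carrier heisenberg"
  then obtain n m k where x: "x = heis_mat n m k"
    by (auto simp: heisenberg_def)
  have "heis_mat (- n) (- m) (n * m - k) ** x = mat 1"
    by (simp add: x heis_mat_mult heis_mat_one heis_mat_inject)
  then show "\<exists>y\<in>carrier heisenberg. y \<otimes>\<^bsub>heisenberg\<^esub> x = \<one>\<^bsub>heisenberg\<^esub>"
    by (auto simp: heisenberg_def)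
qed (auto simp: heisenberg_def heis_mat_mult heis_mat_one matrix_mul_assoc, blast)

text \<open>
  Letters are the group elements themselves, so a word is a list over \<open>S \<union> S\<inverse>\<close>.
  This agrees with words in formal letters whenever the generators and their inverses are
  pairwise distinct, as is the case for \<open>{heis_a, heis_b}\<close>. Words need not be reduced.
\<close>

definition alphabet :: "('a, 'c) monoid_scheme \<Rightarrow> 'a set \<Rightarrow> 'a set" where
  "alphabet G S = S \<union> (\<lambda>s. inv\<^bsub>G\<^esub> s) ` S"

definition group_words :: "('a, 'c) monoid_scheme \<Rightarrow> 'a set \<Rightarrow> 'a list set" where
  "group_words G S = lists (alphabet G S)"

definition word_value :: "('a, 'c) monoid_scheme \<Rightarrow> 'a list \<Rightarrow> 'a" where
  "word_value G w = foldr (\<lambda>x y. x \<otimes>\<^bsub>G\<^esub> y) w \<one>\<^bsub>G\<^esub>"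

definition group_length :: "('a, 'c) monoid_scheme \<Rightarrow> 'a set \<Rightarrow> 'a \<Rightarrow> nat" where
  "group_length G S g = (LEAST n. \<exists>w \<in> group_words G S. word_value G w = g \<and> length w = n)"

definition geodesic_word :: "('a, 'c) monoid_scheme \<Rightarrow> 'a set \<Rightarrow> 'a list \<Rightarrow> bool" where
  "geodesic_word G S w \<longleftrightarrow>
     w \<in> group_words G S \<and> group_length G S (word_value G w) = length w"

definition dead_end_word :: "('a, 'c) monoid_scheme \<Rightarrow> 'a set \<Rightarrow> 'a list \<Rightarrow> bool" where
  "dead_end_word G S w \<longleftrightarrow>
     geodesic_word G S w \<and> (\<forall>s \<in> alphabet G S. \<not> geodesic_word G S (w @ [s]))"

lemma heis_letters_distinct:
  "distinct [heis_a, heis_b, inv\<^bsub>heisenberg\<^esub> heis_a, inv\<^bsub>heisenberg\<^esub> heis_b]"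
proof -
  have a: "inv\<^bsub>heisenberg\<^esub> heis_a = heis_mat (-1) 0 0"
    by (rule group.inv_equality[OF group_heisenberg])
       (auto simp: heisenberg_def heis_a_def heis_mat_mult heis_mat_one)
  have b: "inv\<^bsub>heisenberg\<^esub> heis_b = heis_mat 0 (-1) 0"
    by (rule group.inv_equality[OF group_heisenberg])
       (auto simp: heisenberg_def heis_b_def heis_mat_mult heis_mat_one)
  show ?thesis
    unfolding a b by (simp add: heis_a_def heis_b_def heis_mat_inject)
qed

end

theory Submission
  imports Defs
begin

text \<open>
  Read a word as a lattice path; the element it represents is determined by the endpoint of the
  path and by the area \<open>\<integral> x dy\<close>. For loops the area does not change under rotation, and a loop of
  nonzero area uses all four letters, so a geodesic loop of nonzero area can be rotated to end in
  any letter: it is a dead end word. It remains to extend every geodesic path to a geodesic loop.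
  By the isoperimetric inequality, a loop of length \<open>2s\<close> is geodesic once its area exceeds
  \<open>(s - 1)\<^sup>2 / 4\<close>, and every geodesic path can be completed to such a loop around a box that is
  almost a square. The length of the given path is bounded by rearranging the letters of a path
  along the sides of a box: exchanging adjacent letters changes the area by at most 1, so all
  intermediate areas occur.
\<close>

section \<open>Lattice paths, their endpoints and areas\<close>

definition unit_steps :: "(int \<times> int) set" where
  "unit_steps = {(1, 0), (-1, 0), (0, 1), (0, -1)}"

lemma unit_stepsE:
  assumes "s \<in> unit_steps"
  obtains "s = (1, 0)" | "s = (-1, 0)" | "s = (0, 1)" | "s = (0, -1)"
  using assms by (auto simp: unit_steps_def)

abbreviation dx :: "(int \<times> int) list \<Rightarrow> int" where
  "dx w \<equiv> sum_list (map fst w)"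

abbreviation dy :: "(int \<times> int) list \<Rightarrow> int" where
  "dy w \<equiv> sum_list (map snd w)"

text \<open>This sums \<open>fst s * snd t\<close> over all pairs of a step \<open>s\<close> and a
  later step \<open>t\<close>: the corner entry of the matrix product, and the discrete form of the
  integral.\<close>

fun area :: "(int \<times> int) list \<Rightarrow> int" where
  "area [] = 0"
| "area (s # w) = fst s * dy w + area w"

text \<open>Equality in the group, by \<open>word_value_step_mat\<close>; hence
  \<open>shortest\<close> below means geodesic.\<close>

definition same_end :: "(int \<times> int) list \<Rightarrow> (int \<times> int) list \<Rightarrow> bool" where
  "same_end u w \<longleftrightarrow> dx u = dx w \<and> dy u = dy w \<and> area u = area w"

definition shortest :: "(int \<times> int) list \<Rightarrow> bool" where
  "shortest w \<longleftrightarrow> w \<in> lists unit_steps \<and>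
     (\<forall>u \<in> lists unit_steps. same_end u w \<longrightarrow> length w \<le> length u)"

definition nontrivial_loop :: "(int \<times> int) list \<Rightarrow> bool" where
  "nontrivial_loop w \<longleftrightarrow> dx w = 0 \<and> dy w = 0 \<and> area w \<noteq> 0"

lemma area_append: "area (u @ v) = area u + dx u * dy v + area v"
  by (induction u) (auto simp: algebra_simps)

text \<open>Reversal turns pairs (earlier, later) into pairs (later, earlier). Both kinds together
  make up \<open>dx w * dy w\<close>, because \<open>fst s * snd s = 0\<close> for a unit
  step.\<close>

lemma area_rev:
  "w \<in> lists unit_steps \<Longrightarrow> area (rev w) = dx w * dy w - area w"
proof (induction w)
  case (Cons s w)
  have "dx (rev w) = dx w"
    by (metis rev_map sum_list_rev)
  with Cons show ?case
    by (auto simp: area_append algebra_simps elim!: unit_stepsE)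
qed simp

lemma dx_count:
  "w \<in> lists unit_steps \<Longrightarrow> dx w = int (count_list w (1, 0)) - int (count_list w (-1, 0))"
  by (induction w) (auto elim!: unit_stepsE)

lemma dy_count:
  "w \<in> lists unit_steps \<Longrightarrow> dy w = int (count_list w (0, 1)) - int (count_list w (0, -1))"
  by (induction w) (auto elim!: unit_stepsE)

lemma length_count:
  "w \<in> lists unit_steps \<Longrightarrow>
     length w = count_list w (1, 0) + count_list w (-1, 0) + count_list w (0, 1) + count_list w (0, -1)"
  by (induction w) (auto elim!: unit_stepsE)

lemma area_replicate [simp]: "area (replicate n (x, 0)) = 0" "area (replicate n (0, y)) = 0"
  by (induction n) (auto simp: sum_list_replicate)

subsection \<open>Nontrivial geodesic loops are dead ends\<close>

lemma area_eq_0_if_horizontal: "\<forall>s \<in> set w. snd s = 0 \<Longrightarrow> area w = 0"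
proof (induction w)
  case (Cons s w)
  then have "map snd w = map (\<lambda>_. 0) w" by simp
  then have "dy w = 0" by (simp only: sum_list_0)
  with Cons show ?case by simp
qed simp

lemma area_eq_0_if_vertical: "\<forall>s \<in> set w. fst s = 0 \<Longrightarrow> area w = 0"
  by (induction w) auto

text \<open>Opposite steps are equally frequent in a loop, so a missing step takes its opposite with
  it. The path then stays on a line and has area 0.\<close>

lemma nontrivial_loop_uses_all_steps:
  assumes w: "w \<in> lists unit_steps" and loop: "nontrivial_loop w" and s: "s \<in> unit_steps"
  shows "s \<in> set w"
proof (rule ccontr)
  assume "s \<notin> set w"
  then have 0: "count_list w s = 0"
    by (simp add: count_list_0_iff)
  have eq: "count_list w (1, 0) = count_list w (-1, 0)" "count_list w (0, 1) = count_list w (0, -1)"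
    using dx_count[OF w] dy_count[OF w] loop by (auto simp: nontrivial_loop_def)
  have "((1, 0) \<notin> set w \<and> (-1, 0) \<notin> set w) \<or> ((0, 1) \<notin> set w \<and> (0, -1) \<notin> set w)"
    using 0 eq s unfolding unit_steps_def by (auto simp: count_list_0_iff)
  then have "(\<forall>s \<in> set w. fst s = 0) \<or> (\<forall>s \<in> set w. snd s = 0)"
    using w unfolding unit_steps_def in_lists_conv_set by force
  then show False
    using area_eq_0_if_horizontal area_eq_0_if_vertical loop by (auto simp: nontrivial_loop_def)
qed

text \<open>A loop is a central element. If it factors as x s^-1 y, conjugation by y turns it into y
  x s^-1, so appending s gives the element of \<open>y @ x\<close>, a word shorter by two
  letters.\<close>

lemma nontrivial_loop_dead_end:
  assumes w: "w \<in> lists unit_steps" and loop: "nontrivial_loop w" and s: "s \<in> unit_steps"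
  shows "\<not> shortest (w @ [s])"
proof
  assume short: "shortest (w @ [s])"
  have "(- fst s, - snd s) \<in> unit_steps"
    using s by (auto simp: unit_steps_def)
  then obtain x y where w_eq: "w = x @ (- fst s, - snd s) # y"
    using nontrivial_loop_uses_all_steps[OF w loop] by (meson split_list)
  have dx: "dx x + dx y = fst s" and dy: "dy x + dy y = snd s"
    using loop by (auto simp: nontrivial_loop_def w_eq)
  have 0: "fst s * snd s = 0"
    using s by (auto simp: unit_steps_def)
  have "area (y @ x) = area (w @ [s])"
  proof -
    have eq: "dx y = fst s - dx x" "dy x = snd s - dy y"
      using dx dy by auto
    have "dx y * dy x = fst s * snd s - fst s * dy y - dx x * snd s + dx x * dy y"
      unfolding eq by (simp add: algebra_simps)
    moreover have "area w = area x + dx x * (dy y - snd s) - fst s * dy y + area y"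
      using 0 by (simp add: w_eq area_append algebra_simps)
    moreover have "area (w @ [s]) = area w"
      using loop by (simp add: area_append nontrivial_loop_def del: map_append)
    ultimately show ?thesis
      using 0 by (simp only: area_append) (simp add: algebra_simps)
  qed
  then have "same_end (y @ x) (w @ [s])"
    using dx dy by (simp add: same_end_def w_eq)
  moreover have "y @ x \<in> lists unit_steps"
    using w by (auto simp: w_eq)
  ultimately have "length (w @ [s]) \<le> length (y @ x)"
    using short by (simp only: shortest_def)
  then show False by (simp add: w_eq)
qed

subsection \<open>The isoperimetric inequality\<close>

text \<open>For a path starting at abscissa \<open>x\<close>, the left side is the integral of (X -
  c) dy. Each step up adds at most \<open>d - c\<close>, each step down at most 0.\<close>

lemma area_le_strip:
  assumes "w \<in> lists unit_steps" and "\<And>u. prefix u w \<Longrightarrow> c \<le> x + dx u \<and> x + dx u \<le> d"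
  shows "(x - c) * dy w + area w \<le> (d - c) * int (count_list w (0, 1))"
  using assms
proof (induction w arbitrary: x rule: list.induct)
  case (Cons s w)
  have x: "c \<le> x" "x \<le> d"
    using Cons.prems(2)[of "[]"] by auto
  have "c \<le> x + fst s + dx u \<and> x + fst s + dx u \<le> d" if "prefix u w" for u
    using Cons.prems(2)[of "s # u"] that by (auto simp: algebra_simps)
  then have IH: "(x + fst s - c) * dy w + area w \<le> (d - c) * int (count_list w (0, 1))"
    using Cons.prems(1) by (intro Cons.IH) auto
  have "(x - c) * snd s \<le> (if s = (0, 1) then d - c else 0)"
    using Cons.prems(1) x by (auto simp: unit_steps_def)
  with IH show ?case
    by (auto simp: algebra_simps split: if_splits)
qed simp

lemma dx_prefix_diff_le:
  assumes w: "w \<in> lists unit_steps" and loop: "dx w = 0" and "prefix u w" "prefix v w"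
  shows "dx u - dx v \<le> int (count_list w (1, 0))"
proof -
  have cnt: "count_list w (1, 0) = count_list w (-1, 0)"
    using dx_count[OF w] loop by simp
  consider "prefix v u" | "prefix u v"
    using prefix_same_cases[OF assms(3,4)] by auto
  then show ?thesis
  proof cases
    case 1
    then obtain t r where "u = v @ t" "w = v @ t @ r"
      using \<open>prefix u w\<close> by (auto elim!: prefixE)
    then show ?thesis using w dx_count[of t] by auto
  next
    \<comment> \<open>The way back from \<open>u\<close> to \<open>v\<close> needs at least
      \<open>dx u - dx v\<close> steps to the left, and these are as many as the steps to the
      right.\<close>
    case 2
    then obtain t r where "v = u @ t" "w = u @ t @ r"
      using \<open>prefix v w\<close> by (auto elim!: prefixE)
    then show ?thesis using w dx_count[of t] cnt by auto
  qed
qed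

text \<open>The loop lies in a strip that starts at its least abscissa and is as wide as the number
  of its steps to the right.\<close>

lemma loop_area_le:
  assumes w: "w \<in> lists unit_steps" and loop: "dx w = 0" "dy w = 0"
  shows "area w \<le> int (count_list w (1, 0)) * int (count_list w (0, 1))"
proof -
  let ?P = "dx ` set (prefixes w)"
  define c where "c = Min ?P"
  have "c \<in> ?P"
    unfolding c_def by (intro Min_in) auto
  then obtain v where v: "prefix v w" "c = dx v" by auto
  have "c \<le> 0 + dx u \<and> 0 + dx u \<le> c + int (count_list w (1, 0))" if "prefix u w" for u
    using that dx_prefix_diff_le[OF w loop(1) that v(1)] v(2) Min_le[of ?P "dx u"]
    by (simp add: c_def)
  from area_le_strip[OF w this] loop show ?thesis by simp
qed

lemma isoperimetric:
  assumes w: "w \<in> lists unit_steps" and loop: "dx w = 0" "dy w = 0"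
  obtains h where "length w = 2 * h" "4 * area w \<le> (int h)\<^sup>2"
proof
  let ?p = "count_list w (1, 0)" and ?q = "count_list w (0, 1)"
  show "length w = 2 * (?p + ?q)"
    using length_count[OF w] dx_count[OF w] dy_count[OF w] loop by simp
  \<comment> \<open>The inequality of arithmetic and geometric means, for the sides of the
    box.\<close>
  have "0 \<le> (int ?p - int ?q)\<^sup>2" by simp
  then show "4 * area w \<le> (int (?p + ?q))\<^sup>2"
    using loop_area_le[OF w loop] by (simp add: power2_eq_square algebra_simps)
qed

lemma shortest_loopI:
  assumes "w \<in> lists unit_steps" and "dx w = 0" "dy w = 0"
    and "int (length w) \<le> 2 * s" and "(s - 1)\<^sup>2 < 4 * area w"
  shows "shortest w \<and> nontrivial_loop w"
proof
  have "0 \<le> (s - 1)\<^sup>2" by simp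
  then show "nontrivial_loop w"
    using assms unfolding nontrivial_loop_def by linarith
  show "shortest w"
    unfolding shortest_def
  proof (intro conjI ballI impI)
    fix u assume u: "u \<in> lists unit_steps" "same_end u w"
    then have "dx u = 0" "dy u = 0"
      using assms by (auto simp: same_end_def)
    from isoperimetric[OF u(1) this]
    obtain h where h: "length u = 2 * h" "4 * area u \<le> (int h)\<^sup>2" .
    \<comment> \<open>Competing loops have even length \<open>2 * h\<close>, so excluding h \<le> s
      - 1 already gives length at least \<open>2 * s\<close>.\<close>
    have "(s - 1)\<^sup>2 < (int h)\<^sup>2"
      using u h assms by (simp add: same_end_def)
    then have "s - 1 < int h"
      by (rule power2_less_imp_less) simp
    then show "length w \<le> length u"
      using h assms by simp
  qed (use assms in auto)
qed

subsection \<open>Short paths with a prescribed area\<close>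

text \<open>A discrete intermediate value property. Rearranging letters keeps length and endpoint,
  so only the area varies; \<open>min\<close> and \<open>max\<close> leave open which area is
  larger.\<close>

definition areas_between :: "(int \<times> int) list \<Rightarrow> (int \<times> int) list \<Rightarrow> bool" where
  "areas_between v w \<longleftrightarrow> mset v = mset w \<and>
     {min (area v) (area w)..max (area v) (area w)} \<subseteq> area ` {u. mset u = mset w}"

lemma areas_between_trans:
  assumes "areas_between u v" "areas_between v w"
  shows "areas_between u w"
proof -
  have "{min (area u) (area w)..max (area u) (area w)} \<subseteq>
      {min (area u) (area v)..max (area u) (area v)} \<union> {min (area v) (area w)..max (area v) (area w)}"
    by auto
  then show ?thesis
    using assms unfolding areas_between_def by auto
qed

lemma dy_mset_cong: "mset u = mset w \<Longrightarrow> dy u = dy w"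
  by (metis mset_map sum_mset_sum_list)

lemma dx_mset_cong: "mset u = mset w \<Longrightarrow> dx u = dx w"
  by (metis mset_map sum_mset_sum_list)

lemma areas_between_Cons:
  assumes "areas_between v w"
  shows "areas_between (s # v) (s # w)"
  unfolding areas_between_def
proof (intro conjI subsetI)
  show "mset (s # v) = mset (s # w)"
    using assms by (simp add: areas_between_def)
  fix k assume k: "k \<in> {min (area (s # v)) (area (s # w))..max (area (s # v)) (area (s # w))}"
  have "dy v = dy w"
    using assms by (intro dy_mset_cong) (simp add: areas_between_def)
  with k have "k - fst s * dy w \<in> {min (area v) (area w)..max (area v) (area w)}"
    by (auto simp: min_def max_def split: if_splits)
  then obtain u where u: "mset u = mset w" "k - fst s * dy w = area u"
    using assms unfolding areas_between_def by blast
  then have "area (s # u) = k"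
    using dy_mset_cong[OF u(1)] by simp
  then show "k \<in> area ` {u. mset u = mset (s # w)}"
    using u(1) by (intro image_eqI[of _ _ "s # u"]) simp_all
qed

lemma areas_between_swap:
  assumes "s \<in> unit_steps" "t \<in> unit_steps"
  shows "areas_between (s # t # w) (t # s # w)"
proof -
  have "\<bar>area (s # t # w) - area (t # s # w)\<bar> \<le> 1"
    using assms by (auto simp: unit_steps_def)
  then have "{min (area (s # t # w)) (area (t # s # w))..max (area (s # t # w)) (area (t # s # w))}
      \<subseteq> {area (s # t # w), area (t # s # w)}"
    by (auto simp del: area.simps)
  also have "\<dots> \<subseteq> area ` {u. mset u = mset (t # s # w)}"
    using add_mset_commute by (auto simp del: area.simps)
  finally show ?thesis by (auto simp: areas_between_def)
qed

lemma areas_between_rotate1: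
  "s \<in> unit_steps \<Longrightarrow> w \<in> lists unit_steps \<Longrightarrow> areas_between (s # w) (w @ [s])"
proof (induction w)
  case Nil
  then show ?case by (auto simp: areas_between_def)
next
  case (Cons t w)
  then have "areas_between (s # t # w) (t # s # w)" "areas_between (t # s # w) (t # w @ [s])"
    by (auto intro: areas_between_swap areas_between_Cons)
  then show ?case by (auto intro: areas_between_trans)
qed

lemma areas_between_rev: "w \<in> lists unit_steps \<Longrightarrow> areas_between w (rev w)"
proof (induction w)
  case Nil
  then show ?case by (auto simp: areas_between_def)
next
  case (Cons s w)
  then have "areas_between (s # w) (s # rev w)" "areas_between (s # rev w) (rev w @ [s])"
    by (auto intro: areas_between_Cons areas_between_rotate1)
  then show ?case by (auto intro: areas_between_trans)
qed

text \<open>A path along a \<open>p\<close> by \<open>q\<close> box and its reversal have the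
  extreme areas allowed here, and rearrangements of the same length realise every area in
  between.\<close>

lemma shortest_length_le:
  assumes w: "shortest w" and xy: "0 \<le> dx w" "dx w \<le> p" "0 \<le> dy w" "dy w \<le> q"
    and area: "dx w * dy w - p * q \<le> area w" "area w \<le> p * q"
  shows "int (length w) \<le> 2 * (p + q) - dx w - dy w"
proof -
  \<comment> \<open>Down, right, up and left around the box, ending at the endpoint of
    \<open>w\<close>. Only the \<open>q\<close> steps up, made at abscissa \<open>p\<close>,
    contribute to the area.\<close>
  define v where "v = replicate (nat (q - dy w)) (0, -1) @ replicate (nat p) (1, 0) @
      replicate (nat q) (0, 1) @ replicate (nat (p - dx w)) (-1 :: int, 0 :: int)"
  have v: "v \<in> lists unit_steps" "dx v = dx w" "dy v = dy w" "area v = p * q"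
    "int (length v) = 2 * (p + q) - dx w - dy w"
    using xy by (auto simp: v_def unit_steps_def sum_list_replicate area_append)
  have "area (rev v) \<le> area w" "area w \<le> area v"
    using v area by (auto simp: area_rev)
  then obtain u where u: "mset u = mset (rev v)" "area u = area w"
    using areas_between_rev[OF v(1)] by (force simp: areas_between_def)
  have mset: "mset u = mset v" using u by simp
  then have "u \<in> lists unit_steps"
    using v(1) by (metis in_lists_conv_set set_mset_mset)
  moreover have "same_end u w"
    using dx_mset_cong[OF mset] dy_mset_cong[OF mset] u(2) v by (simp add: same_end_def)
  ultimately have "length w \<le> length u"
    using w by (auto simp: shortest_def)
  also have "length u = length v"
    using mset by (rule mset_eq_length)
  finally show ?thesis using v by simp
qed

subsection \<open>Extending geodesics to geodesic loops\<close>

definition loop_extensible :: "(int \<times> int) list \<Rightarrow> bool" where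
  "loop_extensible w \<longleftrightarrow> (\<exists>v. shortest (w @ v) \<and> nontrivial_loop (w @ v))"

text \<open>
  The path is continued by \<open>b\<^sup>j a\<^sup>-\<^sup>(\<^sup>n\<^sup>+\<^sup>i\<^sup>) b\<^sup>-\<^sup>(\<^sup>m\<^sup>+\<^sup>j\<^sup>) a\<^sup>i\<close>, where \<open>(n, m)\<close> is its endpoint;
  \<open>i\<close> and \<open>j\<close> are later chosen so as to widen the bounding box to an almost square one.
\<close>

lemma loop_extensibleI:
  assumes "w \<in> lists unit_steps" and "0 \<le> dx w" "0 \<le> dy w" "0 \<le> i" "0 \<le> j"
    and "int (length w) \<le> 2 * s - dx w - dy w - 2 * i - 2 * j"
    and "(s - 1)\<^sup>2 < 4 * (area w + dx w * j + i * (dy w + j))"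
  shows "loop_extensible w"
proof -
  define v where "v = replicate (nat j) (0 :: int, 1 :: int) @ replicate (nat (dx w + i)) (-1, 0) @
      replicate (nat (dy w + j)) (0, -1) @ replicate (nat i) (1, 0)"
  have v: "v \<in> lists unit_steps" "dx v = - dx w" "dy v = - dy w"
      "int (length v) = dx w + dy w + 2 * i + 2 * j"
      "area v = dx w * dy w + dx w * j + i * (dy w + j)"
    using assms(2-5) by (auto simp: v_def unit_steps_def sum_list_replicate area_append algebra_simps)
  \<comment> \<open>The summand \<open>dx w * dy w\<close> of \<open>area v\<close> cancels against
    the cross term \<open>dx w * dy v\<close> of the concatenation.\<close>
  then have "w @ v \<in> lists unit_steps" "dx (w @ v) = 0" "dy (w @ v) = 0"
    and "int (length (w @ v)) \<le> 2 * s" and "(s - 1)\<^sup>2 < 4 * area (w @ v)"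
    using assms by (simp_all add: area_append)
  then show ?thesis
    using shortest_loopI unfolding loop_extensible_def by blast
qed

lemma loop_extensible_monotone:
  assumes w: "shortest w" and xy: "0 \<le> dx w" "0 \<le> dy w"
    and area: "0 \<le> area w" "area w \<le> dx w * dy w"
  shows "loop_extensible w"
proof -
  \<comment> \<open>The loop will have the perimeter of a square of side \<open>M\<close> and area
    M^2 - (dx w * dy w - area w). The last entry of the maximum keeps the deficit at most M - 1, and
    4 * (M^2 - M + 1) > (2 * M - 1)^2.\<close>
  define M where "M = max (max (dx w) (dy w)) (dx w * dy w - area w + 1)"
  have M: "dx w \<le> M" "dy w \<le> M" "dx w * dy w - area w + 1 \<le> M"
    by (auto simp: M_def)
  have "int (length w) \<le> dx w + dy w"
    using shortest_length_le[OF w xy(1) order_refl xy(2) order_refl] area by simp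
  moreover have "(2 * M - 1)\<^sup>2 < 4 * (area w + dx w * (M - dy w) + (M - dx w) * (dy w + (M - dy w)))"
    using M by (simp add: power2_eq_square algebra_simps)
  ultimately show ?thesis
    using w xy M
    by (intro loop_extensibleI[where i = "M - dx w" and j = "M - dy w" and s = "2 * M"])
       (auto simp: shortest_def)
qed

text \<open>Take the least \<open>s\<close> with 4 * k \<le> s^2 and halve it, rounding up for
  \<open>p\<close> and down for \<open>q\<close>. As \<open>k\<close> is an integer, it is at most
  the floor of s^2 / 4, which is \<open>p * q\<close>.\<close>

lemma balanced_box:
  fixes k :: int
  assumes "0 < k"
  obtains p q where "0 \<le> q" "q \<le> p" "p \<le> q + 1" "k \<le> p * q" "(p + q - 1)\<^sup>2 < 4 * k"
proof -
  obtain s :: nat where s: "4 * k \<le> (int s)\<^sup>2" "\<And>r. r < s \<Longrightarrow> (int r)\<^sup>2 < 4 * k"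
  proof -
    have "4 * k \<le> (int (nat (4 * k)))\<^sup>2"
      using assms self_le_power[of "4 * k" 2] by simp
    then show ?thesis
      using that exists_least_iff[of "\<lambda>s. 4 * k \<le> (int s)\<^sup>2"] by (metis not_le)
  qed
  have "s \<noteq> 0" using s(1) assms by (intro notI) simp
  then have "(int s - 1)\<^sup>2 < 4 * k"
    using s(2)[of "s - 1"] by (simp add: of_nat_diff)
  moreover have "k \<le> int (s - s div 2) * int (s div 2)"
  proof (cases "even s")
    case True
    then obtain t where "s = 2 * t" by blast
    then show ?thesis using s(1) by (simp add: power2_eq_square)
  next
    case False
    then obtain t where t: "s = 2 * t + 1" by (metis oddE)
    then have "4 * k \<le> 4 * (int t * int t + int t) + 1"
      using s(1) by (simp add: power2_eq_square algebra_simps)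
    then have "k \<le> int t * int t + int t" by presburger
    then show ?thesis using t by (simp add: algebra_simps)
  qed
  ultimately show ?thesis
    by (intro that[of "int (s div 2)" "int (s - s div 2)"]) (auto simp: of_nat_diff)
qed

text \<open>The endpoint fits into a balanced box for the area of \<open>w\<close>, so going
  straight back along the axes closes a loop that is long enough to need that area.\<close>

lemma loop_extensible_large_area:
  assumes w: "shortest w" and xy: "0 \<le> dx w" "0 \<le> dy w"
    and area: "0 < area w" "(dx w)\<^sup>2 \<le> area w" "(dy w)\<^sup>2 \<le> area w"
  shows "loop_extensible w"
proof -
  obtain p q where pq: "0 \<le> q" "q \<le> p" "p \<le> q + 1" "area w \<le> p * q" "(p + q - 1)\<^sup>2 < 4 * area w"
    using balanced_box area(1) by blast
  have le_q: "z \<le> q" if "z\<^sup>2 \<le> area w" for z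
  proof (rule ccontr)
    assume "\<not> z \<le> q"
    \<comment> \<open>Otherwise (q + 1)^2 \<le> z^2 \<le> p * q \<le> (q + 1) * q.\<close>
    then have "(q + 1) * (q + 1) \<le> z * z"
      using pq by (intro mult_mono) auto
    moreover have "p * q \<le> (q + 1) * q"
      using pq by (intro mult_right_mono) auto
    ultimately show False
      using that pq by (simp add: power2_eq_square algebra_simps)
  qed
  have le: "dx w \<le> q" "dy w \<le> q"
    using le_q area by auto
  have "dx w * dy w \<le> p * q"
    using le pq xy by (intro mult_mono) auto
  then have "int (length w) \<le> 2 * (p + q) - dx w - dy w"
    using le pq xy area by (intro shortest_length_le[OF w]) auto
  then show ?thesis
    using w xy pq
    by (intro loop_extensibleI[where i = 0 and j = 0 and s = "p + q"]) (auto simp: shortest_def)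
qed

lemma int_ceil_div:
  fixes k n :: int
  assumes "0 < n"
  obtains q where "k \<le> n * q" "n * (q - 1) < k"
proof
  \<comment> \<open>\<open>r + 1\<close> is \<open>k / n\<close> rounded up.\<close>
  define r where "r = (k - 1) div n"
  have "k - 1 = n * r + (k - 1) mod n" "0 \<le> (k - 1) mod n" "(k - 1) mod n < n"
    using assms by (auto simp: r_def)
  then show "k \<le> n * (r + 1)" "n * ((r + 1) - 1) < k"
    by (auto simp: algebra_simps)
qed

text \<open>The lowest box of width \<open>dx w\<close> with room for the area has height q \<le> dx
  w. Going up by \<open>dx w - q\<close> more yields the perimeter of a square of side
  \<open>dx w\<close>, with an area deficit of \<open>dx w * q - area w\<close>, less than
  \<open>dx w\<close>.\<close>

lemma loop_extensible_wide:
  assumes w: "shortest w" and xy: "0 \<le> dx w" "0 \<le> dy w"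
    and area: "dx w * dy w < area w" "area w < (dx w)\<^sup>2"
  shows "loop_extensible w"
proof -
  have pos: "0 < dx w"
    using xy area by (cases "dx w = 0") auto
  obtain q where q: "area w \<le> dx w * q" "dx w * (q - 1) < area w"
    using int_ceil_div[OF pos] by blast
  have "dx w * dy w < dx w * q" "dx w * (q - 1) < dx w * dx w"
    using q area by (auto simp: power2_eq_square)
  then have le: "dy w < q" "q \<le> dx w"
    using pos by auto
  have "0 \<le> dx w * dy w" "dx w * dy w \<le> dx w * q"
    using xy le by (auto intro: mult_left_mono)
  then have "int (length w) \<le> 2 * (dx w + q) - dx w - dy w"
    using le(1) le(2) q xy area by (intro shortest_length_le[OF w]) linarith+
  moreover have "(2 * dx w - 1)\<^sup>2 < 4 * (area w + dx w * (dx w - q) + 0 * (dy w + (dx w - q)))"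
    using q by (simp add: power2_eq_square algebra_simps)
  ultimately show ?thesis
    using w xy le
    by (intro loop_extensibleI[where i = 0 and j = "dx w - q" and s = "2 * dx w"])
       (auto simp: shortest_def)
qed

text \<open>The analogue with the box widened sideways. Reflection in the diagonal does not reduce
  it to the wide case, since it makes the area negative.\<close>

lemma loop_extensible_tall:
  assumes w: "shortest w" and xy: "0 \<le> dx w" "0 \<le> dy w"
    and area: "dx w * dy w < area w" "area w < (dy w)\<^sup>2"
  shows "loop_extensible w"
proof -
  have pos: "0 < dy w"
    using xy area by (cases "dy w = 0") auto
  obtain p where p: "area w \<le> dy w * p" "dy w * (p - 1) < area w"
    using int_ceil_div[OF pos] by blast
  have "dy w * dx w < dy w * p" "dy w * (p - 1) < dy w * dy w"
    using p area by (auto simp: power2_eq_square mult.commute)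
  then have le: "dx w < p" "p \<le> dy w"
    using pos by auto
  have "0 \<le> dx w * dy w" "dx w * dy w \<le> p * dy w"
    using xy le by (auto intro: mult_right_mono)
  then have "int (length w) \<le> 2 * (p + dy w) - dx w - dy w"
    using le(1) le(2) p xy area unfolding mult.commute[of "dy w" p]
    by (intro shortest_length_le[OF w]) linarith+
  moreover have "(2 * dy w - 1)\<^sup>2 < 4 * (area w + dx w * 0 + (dy w - p) * (dy w + 0))"
    using p by (simp add: power2_eq_square algebra_simps)
  ultimately show ?thesis
    using w xy le
    by (intro loop_extensibleI[where i = "dy w - p" and j = 0 and s = "2 * dy w"])
       (auto simp: shortest_def)
qed

lemma loop_extensible_normalised:
  assumes w: "shortest w" and xy: "0 \<le> dx w" "0 \<le> dy w" and "dx w * dy w \<le> 2 * area w"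
  shows "loop_extensible w"
proof -
  have "0 \<le> dx w * dy w" using xy by simp
  then have "0 \<le> area w" using assms by linarith
  show ?thesis
  proof (cases "area w \<le> dx w * dy w")
    case True
    then show ?thesis using loop_extensible_monotone w xy \<open>0 \<le> area w\<close> by blast
  next
    case False
    then have "0 < area w" "dx w * dy w < area w"
      using \<open>0 \<le> dx w * dy w\<close> by auto
    then show ?thesis
      using loop_extensible_large_area loop_extensible_wide loop_extensible_tall w xy
      by (meson not_le)
  qed
qed

text \<open>
  The symmetries of the square act by automorphisms; \<open>f\<close> below is a reflection in a coordinate
  axis or in the diagonal.
\<close>

lemma loop_extensible_map:
  assumes steps: "f ` unit_steps \<subseteq> unit_steps" and inv: "\<And>s. f (f s) = s"
    and same_end: "\<And>u w. u \<in> lists unit_steps \<Longrightarrow> w \<in> lists unit_steps \<Longrightarrow> same_end u w \<Longrightarrow>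
      same_end (map f u) (map f w)"
    and loop: "\<And>w. w \<in> lists unit_steps \<Longrightarrow> nontrivial_loop w \<Longrightarrow> nontrivial_loop (map f w)"
    and "shortest w" and ext: "shortest (map f w) \<Longrightarrow> loop_extensible (map f w)"
  shows "loop_extensible w"
proof -
  have lists: "map f u \<in> lists unit_steps" if "u \<in> lists unit_steps" for u
    using that steps unfolding in_lists_conv_set set_map by blast
  have inv': "map f (map f u) = u" for u
    by (simp add: map_idI inv)
  have short: "shortest (map f u)" if u: "shortest u" for u
    unfolding shortest_def
  proof (intro conjI ballI impI)
    show "map f u \<in> lists unit_steps"
      using u lists by (auto simp: shortest_def)
    fix v assume v: "v \<in> lists unit_steps" "same_end v (map f u)"
    \<comment> \<open>As \<open>f\<close> is an involution, competitors of \<open>map f u\<close>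
      are carried back to competitors of \<open>u\<close> of the same length.\<close>
    then have "same_end (map f v) u"
      using same_end[OF v(1) _ v(2)] \<open>map f u \<in> lists unit_steps\<close> inv' by metis
    then show "length (map f u) \<le> length v"
      using u lists[OF v(1)] by (auto simp: shortest_def)
  qed
  obtain v where "shortest (map f w @ v)" "nontrivial_loop (map f w @ v)"
    using ext short[OF \<open>shortest w\<close>] by (auto simp: loop_extensible_def)
  moreover from this have "map f w @ v \<in> lists unit_steps"
    by (simp only: shortest_def)
  ultimately have "shortest (map f (map f w @ v))" "nontrivial_loop (map f (map f w @ v))"
    using short loop by blast+
  moreover have "map f (map f w @ v) = w @ map f v"
    using inv'[of w] by simp
  ultimately show ?thesis
    by (auto simp: loop_extensible_def)
qed

lemma dx_dy_area_negx:
  "dx (map (\<lambda>(x, y). (- x, y)) w) = - dx w" "dy (map (\<lambda>(x, y). (- x, y)) w) = dy w"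
  "area (map (\<lambda>(x, y). (- x, y)) w) = - area w"
  by (induction w) (auto split: prod.splits)

lemma dx_dy_area_negy:
  "dx (map (\<lambda>(x, y). (x, - y)) w) = dx w" "dy (map (\<lambda>(x, y). (x, - y)) w) = - dy w"
  "area (map (\<lambda>(x, y). (x, - y)) w) = - area w"
  by (induction w) (auto split: prod.splits)

lemma dx_dy_swap: "dx (map prod.swap w) = dy w" "dy (map prod.swap w) = dx w"
  by (induction w) auto

text \<open>Integration by parts: the integral of y dx is x y minus the integral of x dy. No
  diagonal terms arise, since unit steps are axis-parallel.\<close>

lemma area_swap:
  "w \<in> lists unit_steps \<Longrightarrow> area (map prod.swap w) = dx w * dy w - area w"
  by (induction w) (auto simp: dx_dy_swap algebra_simps simp del: map_map elim!: unit_stepsE)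

lemma loop_extensible_negx:
  assumes "shortest w"
    and "shortest (map (\<lambda>(x, y). (- x, y)) w) \<Longrightarrow> loop_extensible (map (\<lambda>(x, y). (- x, y)) w)"
  shows "loop_extensible w"
  by (rule loop_extensible_map[OF _ _ _ _ assms])
     (auto simp: unit_steps_def same_end_def nontrivial_loop_def dx_dy_area_negx simp del: map_map)

lemma loop_extensible_negy:
  assumes "shortest w"
    and "shortest (map (\<lambda>(x, y). (x, - y)) w) \<Longrightarrow> loop_extensible (map (\<lambda>(x, y). (x, - y)) w)"
  shows "loop_extensible w"
  by (rule loop_extensible_map[OF _ _ _ _ assms])
     (auto simp: unit_steps_def same_end_def nontrivial_loop_def dx_dy_area_negy simp del: map_map)

lemma loop_extensible_swap:
  assumes "shortest w"
    and "shortest (map prod.swap w) \<Longrightarrow> loop_extensible (map prod.swap w)"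
  shows "loop_extensible w"
proof (rule loop_extensible_map[OF _ _ _ _ assms])
  show "prod.swap ` unit_steps \<subseteq> unit_steps" by (auto simp: unit_steps_def)
qed (simp_all add: same_end_def nontrivial_loop_def dx_dy_swap area_swap del: map_map)

lemma shortest_loop_extensible:
  assumes "shortest w"
  shows "loop_extensible w"
proof -
  have 1: "loop_extensible w" if w: "shortest w" "0 \<le> dx w" "0 \<le> dy w" for w
  proof (cases "dx w * dy w \<le> 2 * area w")
    case True
    then show ?thesis using loop_extensible_normalised w by blast
  next
    case False
    \<comment> \<open>The swap replaces the area by \<open>dx w * dy w - area w\<close>, and one of
      the two is at least half of \<open>dx w * dy w\<close>.\<close>
    then have "dx (map prod.swap w) * dy (map prod.swap w) \<le> 2 * area (map prod.swap w)"
      using w by (simp add: dx_dy_swap area_swap shortest_def algebra_simps del: map_map)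
    then show ?thesis
      using w by (intro loop_extensible_swap[OF w(1)] loop_extensible_normalised)
        (simp_all add: dx_dy_swap del: map_map)
  qed
  have 2: "loop_extensible w" if w: "shortest w" "0 \<le> dx w" for w
  proof (cases "0 \<le> dy w")
    case False
    then show ?thesis
      using w by (intro loop_extensible_negy[OF w(1)] 1) (simp_all add: dx_dy_area_negy del: map_map)
  qed (use 1 w in blast)
  show ?thesis
  proof (cases "0 \<le> dx w")
    case False
    then show ?thesis
      using assms
      by (intro loop_extensible_negx[OF assms] 2) (simp_all add: dx_dy_area_negx del: map_map)
  qed (use 2 assms in blast)
qed

subsection \<open>From lattice paths to words\<close>

definition step_mat :: "int \<times> int \<Rightarrow> int^3^3" where
  "step_mat s = heis_mat (fst s) (snd s) 0"

lemma word_value_step_mat: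
  "word_value heisenberg (map step_mat w) = heis_mat (dx w) (dy w) (area w)"
  by (induction w)
     (auto simp: word_value_def heisenberg_def heis_mat_one heis_mat_mult step_mat_def add.commute)

lemma alphabet_heisenberg: "alphabet heisenberg {heis_a, heis_b} = step_mat ` unit_steps"
proof -
  have "inv\<^bsub>heisenberg\<^esub> heis_a = heis_mat (-1) 0 0" "inv\<^bsub>heisenberg\<^esub> heis_b = heis_mat 0 (-1) 0"
    by (rule group.inv_equality[OF group_heisenberg];
        auto simp: heisenberg_def heis_a_def heis_b_def heis_mat_mult heis_mat_one)+
  then show ?thesis
    by (auto simp: alphabet_def unit_steps_def step_mat_def heis_a_def heis_b_def)
qed

lemma group_words_heisenberg:
  "group_words heisenberg {heis_a, heis_b} = map step_mat ` lists unit_steps"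
  by (simp add: group_words_def alphabet_heisenberg lists_image)

text \<open>This replaces \<open>LEAST\<close> by a comparison with all words for the same element,
  the form that \<open>shortest\<close> has.\<close>

lemma geodesic_word_iff_minimal:
  "geodesic_word G S w \<longleftrightarrow> w \<in> group_words G S \<and>
     (\<forall>u \<in> group_words G S. word_value G u = word_value G w \<longrightarrow> length w \<le> length u)"
proof (cases "w \<in> group_words G S")
  case True
  let ?P = "\<lambda>n. \<exists>u \<in> group_words G S. word_value G u = word_value G w \<and> length u = n"
  have "(LEAST n. ?P n) = length w \<longleftrightarrow> (\<forall>n. ?P n \<longrightarrow> length w \<le> n)"
  proof
    show "\<forall>n. ?P n \<longrightarrow> length w \<le> n" if "(LEAST n. ?P n) = length w"
      using that Least_le[of ?P] by metis
    show "(LEAST n. ?P n) = length w" if "\<forall>n. ?P n \<longrightarrow> length w \<le> n"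
      using that True by (intro Least_equality) auto
  qed
  then show ?thesis
    using True by (auto simp: geodesic_word_def group_length_def)
qed (simp add: geodesic_word_def)

lemma geodesic_word_step_mat:
  assumes "w \<in> lists unit_steps"
  shows "geodesic_word heisenberg {heis_a, heis_b} (map step_mat w) \<longleftrightarrow> shortest w"
  using assms
  by (auto simp: geodesic_word_iff_minimal group_words_heisenberg word_value_step_mat shortest_def
      heis_mat_inject same_end_def simp del: map_map)

lemma dead_end_word_step_mat:
  assumes "shortest w" "nontrivial_loop w"
  shows "dead_end_word heisenberg {heis_a, heis_b} (map step_mat w)"
  unfolding dead_end_word_def alphabet_heisenberg
proof (intro conjI ballI)
  have w: "w \<in> lists unit_steps"
    using assms by (simp add: shortest_def)
  then show "geodesic_word heisenberg {heis_a, heis_b} (map step_mat w)"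
    using assms by (simp add: geodesic_word_step_mat)
  fix t assume "t \<in> step_mat ` unit_steps"
  then obtain s where s: "s \<in> unit_steps" "t = step_mat s" by blast
  then have "geodesic_word heisenberg {heis_a, heis_b} (map step_mat (w @ [s])) \<longleftrightarrow> shortest (w @ [s])"
    using w by (intro geodesic_word_step_mat) auto
  then show "\<not> geodesic_word heisenberg {heis_a, heis_b} (map step_mat w @ [t])"
    using nontrivial_loop_dead_end[OF w assms(2) s(1)] s by simp
qed

theorem proposition1p2:
  fixes w :: "(int^3^3) list"
  assumes "geodesic_word heisenberg {heis_a, heis_b} w"
  shows "\<exists>v. dead_end_word heisenberg {heis_a, heis_b} v \<and> prefix w v"
proof -
  have "w \<in> group_words heisenberg {heis_a, heis_b}"
    using assms by (simp add: geodesic_word_def)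
  then obtain u where u: "u \<in> lists unit_steps" "w = map step_mat u"
    by (auto simp: group_words_heisenberg)
  then have "shortest u"
    using assms geodesic_word_step_mat by blast
  then obtain v where "shortest (u @ v)" "nontrivial_loop (u @ v)"
    using shortest_loop_extensible unfolding loop_extensible_def by blast
  then have "dead_end_word heisenberg {heis_a, heis_b} (map step_mat (u @ v))"
    by (rule dead_end_word_step_mat)
  then show ?thesis
    using u by (intro exI[of _ "map step_mat (u @ v)"]) simp
qed

end
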